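(* Let $G$ be a finite group with trivial center and let $q$ be the largest prime divisor of $|G|$ (in particular $|G|>1$). Then: (a) $|\mathrm{Cent}(G)| \geq q+2$, with equality if and only if $G$ is a semidirect product $C_q \rtimes C_n$ (for some positive integer $n$) which is a Frobenius group. (b) $|\mathrm{Cent}(G)| \leq |G|-1$, with equality if and only if $G \cong S_3$.
   Context: For a group $G$ and $x\in G$, $C(x)$ is the centralizer of $x$ in $G$, and $\mathrm{Cent}(G)=\{C(x) : x\in G\}$ is the set of all element centralizers (including $G=C(1)$). $C_m$ denotes the cyclic group of order $m$. In $C_q\rtimes C_n$, the factor $C_q$ is the normal subgroup; the group being Frobenius means that it is a Frobenius group with kernel $C_q$ and complement $C_n$. $S_3$ is the symmetric group of degree $3$. *)

theory Defs
  imports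
    "HOL-Algebra.Elementary_Groups"
    "HOL-Algebra.Sym_Groups"
    "HOL-Computational_Algebra.Primes"
begin

definition centralizer :: "('a, 'b) monoid_scheme \<Rightarrow> 'a \<Rightarrow> 'a set" where
  "centralizer G x = {g \<in> carrier G. g \<otimes>\<^bsub>G\<^esub> x = x \<otimes>\<^bsub>G\<^esub> g}"

definition Cent :: "('a, 'b) monoid_scheme \<Rightarrow> 'a set set" where
  "Cent G = centralizer G ` carrier G"

definition center :: "('a, 'b) monoid_scheme \<Rightarrow> 'a set" where
  "center G = {z \<in> carrier G. \<forall>g\<in>carrier G. z \<otimes>\<^bsub>G\<^esub> g = g \<otimes>\<^bsub>G\<^esub> z}"

text \<open>Internal semidirect product \<open>K \<rtimes> H\<close>, with normal factor \<open>K\<close>.\<close>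

definition is_semidirect_product ::
    "('a, 'b) monoid_scheme \<Rightarrow> 'a set \<Rightarrow> 'a set \<Rightarrow> bool" where
  "is_semidirect_product G K H \<longleftrightarrow>
     K \<lhd> G \<and> subgroup H G \<and> K \<inter> H = {\<one>\<^bsub>G\<^esub>} \<and> K <#>\<^bsub>G\<^esub> H = carrier G"

definition conjugate_set :: "('a, 'b) monoid_scheme \<Rightarrow> 'a \<Rightarrow> 'a set \<Rightarrow> 'a set" where
  "conjugate_set G g H = g <#\<^bsub>G\<^esub> H #>\<^bsub>G\<^esub> inv\<^bsub>G\<^esub> g"

definition frobenius_complement :: "('a, 'b) monoid_scheme \<Rightarrow> 'a set \<Rightarrow> bool" where
  "frobenius_complement G H \<longleftrightarrow>
     subgroup H G \<and> H \<noteq> {\<one>\<^bsub>G\<^esub>} \<and> H \<noteq> carrier G \<and>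
     (\<forall>g \<in> carrier G - H. H \<inter> conjugate_set G g H = {\<one>\<^bsub>G\<^esub>})"

text \<open>The Frobenius kernel consists of \<open>\<one>\<close> and the elements lying in no conjugate of
  the complement.\<close>

definition frobenius_kernel :: "('a, 'b) monoid_scheme \<Rightarrow> 'a set \<Rightarrow> 'a set" where
  "frobenius_kernel G H =
     insert \<one>\<^bsub>G\<^esub> (carrier G - (\<Union>g\<in>carrier G. conjugate_set G g H))"

definition cyclic_subgroup_of_order ::
    "('a, 'b) monoid_scheme \<Rightarrow> nat \<Rightarrow> 'a set \<Rightarrow> bool" where
  "cyclic_subgroup_of_order G m K \<longleftrightarrow>
     subgroup K G \<and> cyclic_group (G\<lparr>carrier := K\<rparr>) \<and> finite K \<and> card K = m"

definition is_frobenius_cyclic_semidirect ::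
    "('a, 'b) monoid_scheme \<Rightarrow> nat \<Rightarrow> nat \<Rightarrow> bool" where
  "is_frobenius_cyclic_semidirect G m n \<longleftrightarrow>
     (\<exists>K H. cyclic_subgroup_of_order G m K \<and> cyclic_subgroup_of_order G n H \<and>
        is_semidirect_product G K H \<and>
        frobenius_complement G H \<and> K = frobenius_kernel G H)"

end

theory Submission
  imports Defs "HOL-Algebra.Group_Action" "HOL-Algebra.Sylow" "HOL-Number_Theory.Residues"
begin

text \<open>
  Conjugation permutes the centralizers of the elements of \<open>G\<close>: the conjugate of \<open>C(y)\<close> by \<open>g\<close> is the centralizer of the conjugate of \<open>y\<close>.

  For the lower bound, an element \<open>x\<close> of order \<open>q\<close> acts on the set of centralizers and fixes \<open>G\<close> and
  \<open>C(x)\<close>, which differ because the center is trivial. If it moves some \<open>C(y)\<close>, the orbit of \<open>C(y)\<close> has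
  prime length \<open>q\<close> and there are at least \<open>q + 2\<close> centralizers. Such a \<open>y\<close> exists when \<open>x\<close> is chosen
  central in a Sylow \<open>q\<close>-subgroup (lemma \<open>moved_centralizer_exists\<close>). If \<open>x\<close> moved no centralizer, every \<open>a\<close>
  would commute with its conjugate under \<open>x\<close>. Then the commutator of \<open>x\<close> and \<open>a\<close> commutes with both of
  them, so it is trivial when \<open>a\<close> has order prime to \<open>q\<close>, and \<open>x\<close> would be central.

  If there are exactly \<open>q + 2\<close> centralizers, the proper ones are \<open>C(x)\<close> and \<open>q\<close> conjugates of \<open>C(y)\<close>, and
  they cover the group. Counting shows that \<open>C(x)\<close> has order \<open>q\<close>, meets \<open>C(y)\<close> trivially and is
  complemented by it (lemma \<open>card_Cent_eq_imp_frobenius\<close>). The complement acts faithfully on a group of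
  order \<open>q\<close>, so it is cyclic. Conversely, in a Frobenius group with cyclic kernel and cyclic complement
  all centralizers can be listed.

  For the upper bound, \<open>z\<close> and its inverse have the same centralizer, and not every element is its own
  inverse because the center is trivial. Equality means that this is the only coincidence. Then all
  elements but one pair of mutually inverse ones are involutions or trivial, and the group has order
  \<open>6\<close> (lemma \<open>many_centralizers_imp_sym_group_3\<close>). In the symmetric group of degree \<open>3\<close> the two bounds
  coincide.
\<close>

section \<open>Conjugation and centralizers\<close>

context group
begin

definition conjg :: "'a \<Rightarrow> 'a \<Rightarrow> 'a" where
  "conjg g a = g \<otimes> a \<otimes> inv g"

lemma conjg_closed [simp]: "g \<in> carrier G \<Longrightarrow> a \<in> carrier G \<Longrightarrow> conjg g a \<in> carrier G"
  by (simp add: conjg_def)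

lemma conjg_mult:
  "g \<in> carrier G \<Longrightarrow> a \<in> carrier G \<Longrightarrow> b \<in> carrier G \<Longrightarrow>
     conjg g (a \<otimes> b) = conjg g a \<otimes> conjg g b"
  by (simp add: conjg_def m_assoc) (simp flip: m_assoc)

lemma conjg_conjg:
  "g \<in> carrier G \<Longrightarrow> h \<in> carrier G \<Longrightarrow> a \<in> carrier G \<Longrightarrow>
     conjg g (conjg h a) = conjg (g \<otimes> h) a"
  by (simp add: conjg_def m_assoc inv_mult_group)

lemma conjg_by_one [simp]: "a \<in> carrier G \<Longrightarrow> conjg \<one> a = a"
  by (simp add: conjg_def)

lemma conjg_one [simp]: "g \<in> carrier G \<Longrightarrow> conjg g \<one> = \<one>"
  by (simp add: conjg_def)

lemma conjg_inv_conjg [simp]: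
  "g \<in> carrier G \<Longrightarrow> a \<in> carrier G \<Longrightarrow> conjg (inv g) (conjg g a) = a"
  "g \<in> carrier G \<Longrightarrow> a \<in> carrier G \<Longrightarrow> conjg g (conjg (inv g) a) = a"
  by (simp_all add: conjg_conjg)

lemma conjg_inv:
  "g \<in> carrier G \<Longrightarrow> a \<in> carrier G \<Longrightarrow> conjg g (inv a) = inv (conjg g a)"
  by (simp add: conjg_def inv_mult_group m_assoc)

lemma conjg_pow:
  "g \<in> carrier G \<Longrightarrow> a \<in> carrier G \<Longrightarrow> conjg g (a [^] (n::nat)) = conjg g a [^] n"
  by (induction n) (simp_all add: conjg_mult)

lemma conjg_eq_iff [simp]:
  assumes "g \<in> carrier G" "a \<in> carrier G" "b \<in> carrier G"
  shows "conjg g a = conjg g b \<longleftrightarrow> a = b"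
  using assms by (metis conjg_inv_conjg(1))

lemma conjg_fixes_iff:
  assumes "g \<in> carrier G" "a \<in> carrier G"
  shows "conjg g a = a \<longleftrightarrow> g \<otimes> a = a \<otimes> g"
  unfolding conjg_def using assms by (metis inv_closed inv_solve_right' m_closed)

lemma inj_on_conjg: "g \<in> carrier G \<Longrightarrow> inj_on (conjg g) (carrier G)"
  by (auto simp: inj_on_def)

lemma conjg_image_conjg_image:
  assumes "g \<in> carrier G" "h \<in> carrier G" "S \<subseteq> carrier G"
  shows "conjg g ` conjg h ` S = conjg (g \<otimes> h) ` S"
  using assms by (force simp: image_image conjg_conjg subset_iff)

lemma conjg_image_by_one: "S \<subseteq> carrier G \<Longrightarrow> conjg \<one> ` S = S"
  by (force simp: subset_iff)

lemma conjg_image_closed: "g \<in> carrier G \<Longrightarrow> S \<subseteq> carrier G \<Longrightarrow> conjg g ` S \<subseteq> carrier G"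
  by (auto simp: subset_iff)

lemma conjg_image_cancel:
  assumes "g \<in> carrier G" "S \<subseteq> carrier G" "T \<subseteq> carrier G"
  shows "conjg g ` S = conjg g ` T \<longleftrightarrow> S = T"
  using assms by (meson inj_on_conjg inj_on_image_eq_iff)

lemma conjugate_set_eq_conjg_image: "conjugate_set G g H = conjg g ` H"
  unfolding conjugate_set_def conjg_def l_coset_def r_coset_def by blast

lemma card_conjg_image: "g \<in> carrier G \<Longrightarrow> S \<subseteq> carrier G \<Longrightarrow> card (conjg g ` S) = card S"
  by (meson card_image inj_on_conjg inj_on_subset)

lemma in_centralizer: "g \<in> centralizer G x \<longleftrightarrow> g \<in> carrier G \<and> g \<otimes> x = x \<otimes> g"
  by (auto simp: centralizer_def)

lemma centralizer_subset: "centralizer G x \<subseteq> carrier G"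
  by (auto simp: centralizer_def)

lemma in_centralizer_iff_conjg:
  "x \<in> carrier G \<Longrightarrow> g \<in> centralizer G x \<longleftrightarrow> g \<in> carrier G \<and> conjg g x = x"
  using conjg_fixes_iff in_centralizer by blast

lemma in_centralizer_swap:
  "x \<in> carrier G \<Longrightarrow> g \<in> centralizer G x \<Longrightarrow> x \<in> centralizer G g"
  by (simp add: in_centralizer)

lemma in_centralizer_self: "x \<in> carrier G \<Longrightarrow> x \<in> centralizer G x"
  by (simp add: in_centralizer)

lemma subgroup_centralizer:
  assumes "x \<in> carrier G"
  shows "subgroup (centralizer G x) G"
proof (rule subgroupI)
  fix a assume "a \<in> centralizer G x"
  then show "inv a \<in> centralizer G x"
    using assms by (metis conjg_inv_conjg(1) in_centralizer_iff_conjg inv_closed)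
next
  fix a b assume "a \<in> centralizer G x" "b \<in> centralizer G x"
  then show "a \<otimes> b \<in> centralizer G x"
    using assms by (simp add: in_centralizer_iff_conjg flip: conjg_conjg)
qed (use assms in_centralizer_self centralizer_subset in auto)

lemma centralizer_conjg:
  assumes "g \<in> carrier G" "x \<in> carrier G"
  shows "centralizer G (conjg g x) = conjg g ` centralizer G x"
proof
  show "centralizer G (conjg g x) \<subseteq> conjg g ` centralizer G x"
  proof
    fix a assume a: "a \<in> centralizer G (conjg g x)"
    then have "conjg g (conjg (inv g) a \<otimes> x) = conjg g (x \<otimes> conjg (inv g) a)"
      using assms by (simp add: conjg_mult in_centralizer)
    with a assms have "conjg (inv g) a \<in> centralizer G x"
      by (subst (asm) conjg_eq_iff) (auto simp: in_centralizer)
    moreover have "a = conjg g (conjg (inv g) a)"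
      using a assms by (simp add: in_centralizer)
    ultimately show "a \<in> conjg g ` centralizer G x" by blast
  qed
  show "conjg g ` centralizer G x \<subseteq> centralizer G (conjg g x)"
    using assms by (auto simp: in_centralizer simp flip: conjg_mult)
qed

lemma in_center: "z \<in> center G \<longleftrightarrow> z \<in> carrier G \<and> centralizer G z = carrier G"
  unfolding center_def centralizer_def by (auto simp: set_eq_iff) metis

lemma centralizer_one: "centralizer G \<one> = carrier G"
  by (auto simp: centralizer_def)

section \<open>Elements and subgroups of prime power order\<close>

text \<open>Exponents of an element killed by \<open>q\<close> may be treated as residues modulo \<open>q\<close>; this is how
  congruences between integers enter the group.\<close>

lemma pow_mod_eq:
  assumes "x \<in> carrier G" "x [^] (q::nat) = \<one>"
  shows "x [^] (n mod q) = x [^] n"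
proof -
  have "x [^] n = x [^] (q * (n div q) + n mod q)" by simp
  also have "\<dots> = (x [^] q) [^] (n div q) \<otimes> x [^] (n mod q)"
    using assms(1) by (simp only: nat_pow_mult nat_pow_pow)
  finally show ?thesis using assms by simp
qed

text \<open>The conjugacy class of a non-central element has size a power of \<open>p\<close> other than \<open>1\<close>, so \<open>p\<close>
  divides the number of non-central elements and hence the order of the center.\<close>

lemma prime_power_group_center_nontrivial:
  assumes p: "prime p" and ord: "order G = p ^ a" and a: "a > 0"
  shows "\<exists>z\<in>center G. z \<noteq> \<one>"
proof -
  define \<phi> where "\<phi> = (\<lambda>g. \<lambda>h\<in>carrier G. g \<otimes> h \<otimes> inv g)"
  interpret A: group_action G "carrier G" \<phi>
    unfolding \<phi>_def by (rule action_by_conjugation)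
  have fin: "finite (carrier G)"
    using ord p by (metis card.infinite order_def power_not_zero not_prime_0)
  have ph: "\<phi> g h = conjg g h" if "h \<in> carrier G" for g h
    using that by (simp add: \<phi>_def conjg_def)
  \<comment> \<open>Summing this weight over the classes counts the non-central elements class by class.\<close>
  define f where "f = (\<lambda>x. if x \<in> center G then 0 else 1 :: nat)"
  have cen: "h \<in> center G \<longleftrightarrow> (\<forall>g\<in>carrier G. conjg g h = h)" if "h \<in> carrier G" for h
    using that unfolding center_def by (auto simp: conjg_fixes_iff)
  have sub: "center G \<subseteq> carrier G" by (auto simp: center_def)
  have orb: "p dvd (\<Sum>x\<in>Q. f x)" if Q: "Q \<in> orbits G (carrier G) \<phi>" for Q
  proof -
    from Q obtain h where h: "h \<in> carrier G" and Qh: "Q = orbit G \<phi> h"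
      unfolding orbits_def by blast
    have Q': "Q = (\<lambda>g. conjg g h) ` carrier G"
      unfolding Qh orbit_def using h ph by auto
    show ?thesis
    proof (cases "h \<in> center G")
      case True
      then have "Q = {h}" unfolding Q' using cen[OF h] by force
      then show ?thesis using True by (simp add: f_def)
    next
      case False
      have nc: "x \<notin> center G" if "x \<in> Q" for x
      proof
        assume x: "x \<in> center G"
        from that obtain g where g: "g \<in> carrier G" "x = conjg g h" unfolding Q' by blast
        have "conjg (inv g) x = x" using x g h cen[of x] by simp
        then have "x = h" using g h by simp
        with x False show False by simp
      qed
      have "card Q dvd p ^ a"
        using A.orbit_stabilizer_theorem[OF h] ord unfolding Qh by (metis dvd_triv_left)
      moreover have "card Q \<noteq> 1"
      proof
        assume "card Q = 1"
        then obtain u where u: "Q = {u}" by (meson card_1_singletonE)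
        moreover have "h \<in> Q" unfolding Q' using h by (metis conjg_by_one image_eqI one_closed)
        ultimately have "\<forall>g\<in>carrier G. conjg g h = h" unfolding Q' by (metis image_eqI singletonD)
        then show False using False cen h by blast
      qed
      ultimately have "p dvd card Q"
        using p by (metis divides_primepow_nat dvd_power power_0 gr0I)
      moreover have "(\<Sum>x\<in>Q. f x) = card Q" using nc by (simp add: f_def)
      ultimately show ?thesis by simp
    qed
  qed
  have "(\<Sum>x\<in>carrier G. f x) = (\<Sum>Q\<in>orbits G (carrier G) \<phi>. \<Sum>x\<in>Q. f x)"
    using A.disjoint_sum[OF fin, of f] by simp
  then have "p dvd (\<Sum>x\<in>carrier G. f x)" using orb by (simp add: dvd_sum)
  moreover have "(\<Sum>x\<in>carrier G. f x) = order G - card (center G)"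
  proof -
    have "(\<Sum>x\<in>carrier G. f x) = (\<Sum>x\<in>carrier G - center G. f x)"
      by (rule sum.mono_neutral_right) (use fin in \<open>auto simp: f_def\<close>)
    also have "\<dots> = card (carrier G - center G)" by (simp add: f_def)
    finally show ?thesis
      using card_Diff_subset[OF finite_subset[OF sub fin] sub] by (simp add: order_def)
  qed
  moreover have "p dvd order G" using ord a by (simp add: dvd_power)
  moreover have "card (center G) \<le> order G" unfolding order_def using sub fin card_mono by blast
  ultimately have "p dvd card (center G)"
    by (metis dvd_diffD1)
  moreover have "\<one> \<in> center G" by (simp add: in_center centralizer_one)
  ultimately have "card (center G) \<noteq> 1" "\<one> \<in> center G" using p by auto
  then show ?thesis by (metis is_singletonI' is_singleton_altdef empty_iff)
qed

text \<open>Raising \<open>z\<close> to the \<open>p\<close>-th power repeatedly, the last non-trivial element reached has order \<open>p\<close>.\<close>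

lemma prime_order_power_exists:
  assumes p: "prime p" and z: "z \<in> carrier G" "z [^] (p ^ a :: nat) = \<one>" "z \<noteq> \<one>"
  shows "\<exists>n::nat. z [^] n \<noteq> \<one> \<and> (z [^] n) [^] p = \<one>"
proof -
  define b where "b = (LEAST b. z [^] (p ^ b :: nat) = \<one>)"
  have b: "z [^] (p ^ b :: nat) = \<one>" unfolding b_def by (rule LeastI[of _ a]) (rule z(2))
  then obtain c where c: "b = Suc c" using z by (cases b) auto
  have "z [^] (p ^ c :: nat) \<noteq> \<one>"
    using c unfolding b_def by (metis (mono_tags, lifting) lessI not_less_Least)
  moreover have "(z [^] (p ^ c :: nat)) [^] p = \<one>"
    using b z c by (simp add: nat_pow_pow mult.commute)
  ultimately show ?thesis by blast
qed

lemma sylow_subgroup_exists: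
  assumes "finite (carrier G)" "prime p"
  obtains P where "subgroup P G" "card P = p ^ multiplicity p (order G)"
proof -
  have "order G = p ^ multiplicity p (order G) * (order G div p ^ multiplicity p (order G))"
    by (simp add: multiplicity_dvd)
  then show ?thesis using sylow_thm[OF assms(2) is_group _ assms(1)] that by blast
qed

lemma subgroup_pow_card:
  assumes P: "subgroup P G" and x: "x \<in> P"
  shows "x [^] card P = \<one>"
proof -
  interpret P: group "G\<lparr>carrier := P\<rparr>" using P by (rule subgroup_imp_group)
  have "x [^]\<^bsub>G\<lparr>carrier := P\<rparr>\<^esub> order (G\<lparr>carrier := P\<rparr>) = \<one>\<^bsub>G\<lparr>carrier := P\<rparr>\<^esub>"
    using x by (intro P.pow_order_eq_1) auto
  then show ?thesis by (simp add: order_def nat_pow_def)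
qed

lemma subgroup_nat_pow_closed:
  assumes "subgroup P G" "x \<in> P"
  shows "x [^] (n::nat) \<in> P"
  using assms by (induction n) (auto simp: subgroup.one_closed subgroup.m_closed)

lemma card_subgroup_dvd_order: "subgroup P G \<Longrightarrow> card P dvd order G"
  using lagrange by (metis dvd_triv_right)

lemma card_subgroup_dvd_card:
  assumes "subgroup P G" "subgroup Q G" "P \<subseteq> Q"
  shows "card P dvd card Q"
proof -
  interpret Q: group "G\<lparr>carrier := Q\<rparr>" using assms(2) by (rule subgroup_imp_group)
  have "subgroup P (G\<lparr>carrier := Q\<rparr>)"
    using assms by (simp add: subgroup_incl)
  then show ?thesis using Q.card_subgroup_dvd_order by (force simp: order_def)
qed

text \<open>The element is taken in the center of a Sylow subgroup, which is non-trivial; then that Sylow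
  subgroup lies in the centralizer, which gives the divisibility.\<close>

lemma sylow_central_element:
  assumes fin: "finite (carrier G)" and p: "prime p" and d: "p dvd order G"
  obtains x where "x \<in> carrier G" "x \<noteq> \<one>" "x [^] p = \<one>"
    "p ^ multiplicity p (order G) dvd card (centralizer G x)"
proof -
  let ?a = "multiplicity p (order G)"
  obtain P where P: "subgroup P G" "card P = p ^ ?a"
    using sylow_subgroup_exists[OF fin p] .
  interpret P: group "G\<lparr>carrier := P\<rparr>" using P(1) by (rule subgroup_imp_group)
  have "order G \<noteq> 0" using fin by (simp add: order_def card_eq_0_iff carrier_not_empty)
  then have "?a > 0"
    using d p by (metis gr0I not_dvd_imp_multiplicity_0 multiplicity_eq_zero_iff not_prime_unit)
  then obtain z where z: "z \<in> center (G\<lparr>carrier := P\<rparr>)" "z \<noteq> \<one>"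
    using P.prime_power_group_center_nontrivial[OF p, of ?a] P(2) by (auto simp: order_def)
  have zc: "z \<otimes> g = g \<otimes> z" if "g \<in> P" for g
    using z(1) that P(1) by (auto simp: center_def)
  have zP: "z \<in> P" using z(1) by (simp add: center_def)
  have zG: "z \<in> carrier G" using P(1) zP by (rule subgroup.mem_carrier)
  obtain n where n: "z [^] (n::nat) \<noteq> \<one>" "(z [^] n) [^] p = \<one>"
    using prime_order_power_exists[OF p zG _ z(2), of ?a] subgroup_pow_card[OF P(1) zP] P(2) by auto
  have "P \<subseteq> centralizer G (z [^] n)"
  proof
    fix g assume g: "g \<in> P"
    have gG: "g \<in> carrier G" using P(1) g by (rule subgroup.mem_carrier)
    have "conjg g z = z" using zc[OF g] gG zG by (simp add: conjg_fixes_iff)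
    then show "g \<in> centralizer G (z [^] n)"
      using gG zG by (simp add: in_centralizer_iff_conjg conjg_pow)
  qed
  then have "card P dvd card (centralizer G (z [^] n))"
    using P(1) zG by (intro card_subgroup_dvd_card subgroup_centralizer) auto
  then show ?thesis using that[of "z [^] n"] n zG P(2) by simp
qed

section \<open>An element of prime order that moves a centralizer\<close>

text \<open>Let \<open>c\<close> be the commutator of \<open>x\<close> and \<open>a\<close>. If conjugation by \<open>x\<close> preserves every centralizer, then
  every \<open>b\<close> commutes with its conjugate under \<open>x\<close>. For \<open>b = a\<close> this says that \<open>c\<close> commutes with \<open>a\<close>.
  For \<open>b = x a\<close>, after conjugating back by \<open>x\<close>, it says that \<open>c\<close> commutes with \<open>a x\<close>. Both together
  make \<open>c\<close> commute with \<open>x\<close>.\<close>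

lemma commutator_central_if_centralizers_fixed:
  assumes x: "x \<in> carrier G" and a: "a \<in> carrier G"
    and fixd: "\<And>b. b \<in> carrier G \<Longrightarrow> centralizer G (conjg x b) = centralizer G b"
  shows "conjg x a \<otimes> inv a \<in> centralizer G a \<inter> centralizer G x"
proof -
  define c where "c = conjg x a \<otimes> inv a"
  have cG: "c \<in> carrier G" using x a by (simp add: c_def)
  have comm: "conjg x b \<otimes> inv b \<in> centralizer G b" if b: "b \<in> carrier G" for b
  proof -
    have "conjg x b \<in> centralizer G b"
      using fixd[OF b] in_centralizer_self[of "conjg x b"] x b by simp
    then show ?thesis
      using subgroup_centralizer[OF b] in_centralizer_self[OF b]
      by (simp add: subgroup.m_closed subgroup.m_inv_closed)
  qed
  have ca: "c \<in> centralizer G a" using comm[OF a] by (simp add: c_def)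
  \<comment> \<open>The second use of the hypothesis, for \<open>x \<otimes> a\<close>.\<close>
  have "conjg x (x \<otimes> a) \<otimes> inv (x \<otimes> a) = conjg x c"
    using x a by (simp add: conjg_def c_def m_assoc inv_mult_group inv_solve_left')
  then have "conjg x c \<in> centralizer G (x \<otimes> a)" using comm[of "x \<otimes> a"] x a by simp
  moreover have "x \<otimes> a = conjg x (a \<otimes> x)"
    using x a by (simp add: conjg_def m_assoc)
  ultimately have "conjg x c \<in> conjg x ` centralizer G (a \<otimes> x)"
    using x a by (simp add: centralizer_conjg)
  then have cax: "c \<in> centralizer G (a \<otimes> x)"
    using x cG centralizer_subset[of "a \<otimes> x"] by (auto simp: subset_iff)
  have "a \<in> centralizer G c" "a \<otimes> x \<in> centralizer G c"
    using ca cax a x by (auto simp: in_centralizer)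
  then have "inv a \<otimes> (a \<otimes> x) \<in> centralizer G c"
    using subgroup_centralizer[OF cG] by (simp add: subgroup.m_closed subgroup.m_inv_closed)
  then have "x \<in> centralizer G c" using a x by (simp flip: m_assoc)
  then have "c \<in> centralizer G x" using cG x by (simp add: in_centralizer)
  with ca show ?thesis by (simp add: c_def)
qed

text \<open>Since the commutator \<open>c\<close> commutes with both \<open>x\<close> and \<open>a\<close>, its powers are the commutators of powers
  of \<open>x\<close>, or of \<open>a\<close>. So \<open>c\<^sup>m = c\<^sup>n = 1\<close>, and coprimality of \<open>m\<close> and \<open>n\<close> forces \<open>c = 1\<close>.\<close>

lemma commute_if_centralizers_fixed_and_coprime:
  assumes x: "x \<in> carrier G" "x [^] (m::nat) = \<one>" and a: "a \<in> carrier G" "a [^] (n::nat) = \<one>"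
    and co: "coprime m n"
    and fixd: "\<And>b. b \<in> carrier G \<Longrightarrow> centralizer G (conjg x b) = centralizer G b"
  shows "a \<in> centralizer G x"
proof -
  define c where "c = conjg x a \<otimes> inv a"
  have cG: "c \<in> carrier G" using x a by (simp add: c_def)
  have ca: "c \<otimes> a = a \<otimes> c" and cx: "c \<otimes> x = x \<otimes> c"
    using commutator_central_if_centralizers_fixed[OF x(1) a(1) fixd]
    by (auto simp: c_def in_centralizer)
  have 1: "conjg x a = c \<otimes> a" using x a by (simp add: c_def m_assoc)
  have "\<one> = conjg x (a [^] n)" using a x by simp
  also have "\<dots> = c [^] n \<otimes> a [^] n"
    using a(1) x(1) cG by (simp only: conjg_pow pow_mult_distrib[OF ca] 1)
  finally have cn: "c [^] n = \<one>" using cG a by simp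
  have 2: "conjg a x = inv c \<otimes> x"
  proof -
    have "c \<otimes> conjg a x = x"
      unfolding conjg_def using 1[unfolded conjg_def] x a cG
      by (metis inv_closed inv_solve_right' m_assoc m_closed)
    then show ?thesis using cG a x by (metis conjg_closed inv_solve_left)
  qed
  have ic: "inv c \<otimes> x = x \<otimes> inv c"
    using cx cG x by (metis inv_closed inv_solve_left inv_solve_right m_assoc m_closed)
  have "\<one> = conjg a (x [^] m)" using a x by simp
  also have "\<dots> = inv c [^] m \<otimes> x [^] m"
    using a(1) x(1) cG by (simp only: conjg_pow pow_mult_distrib[OF ic] inv_closed 2)
  finally have "inv (c [^] m) = \<one>" using cG x by (simp add: nat_pow_inv)
  then have cm: "c [^] m = \<one>" using cG by (metis inv_inv inv_one nat_pow_closed)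
  have "ord c dvd m" "ord c dvd n" using cm cn cG pow_eq_id by auto
  then have "ord c = 1" using co by (metis coprime_common_divisor_nat)
  then have "c = \<one>" using ord_eq_1[OF cG] by blast
  then have "conjg x a = a" using 1 a by simp
  then show ?thesis using x a by (simp add: conjg_fixes_iff in_centralizer)
qed

text \<open>The order of the centralizer is then divisible by every prime power exactly dividing the group
  order, hence by the group order itself.\<close>

lemma sylow_subgroups_centralize_imp_central:
  assumes fin: "finite (carrier G)" and x: "x \<in> carrier G"
    and dvd: "\<And>p. prime p \<Longrightarrow> p ^ multiplicity p (order G) dvd card (centralizer G x)"
  shows "x \<in> center G"
proof -
  have pos: "order G \<noteq> 0" using fin by (simp add: order_def card_eq_0_iff carrier_not_empty)
  have nz: "card (centralizer G x) \<noteq> 0"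
    using card_subgroup_dvd_order[OF subgroup_centralizer[OF x]] pos by auto
  have "order G dvd card (centralizer G x)"
  proof (rule multiplicity_le_imp_dvd)
    fix p :: nat assume "prime p"
    then show "multiplicity p (order G) \<le> multiplicity p (card (centralizer G x))"
      using dvd nz
      by (intro multiplicity_geI) (auto dest: not_prime_unit)
  qed (use pos in auto)
  then have "card (centralizer G x) = order G"
    using card_subgroup_dvd_order[OF subgroup_centralizer[OF x]] by (simp add: dvd_antisym)
  then show ?thesis
    using fin x centralizer_subset by (simp add: in_center order_def card_subset_eq)
qed

text \<open>Take \<open>x\<close> of order \<open>q\<close> in the center of a Sylow \<open>q\<close>-subgroup. If conjugation by \<open>x\<close> preserved every
  centralizer, then \<open>x\<close> would commute with all elements of order prime to \<open>q\<close>, so with every Sylow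
  subgroup for the other primes, and it already commutes with one for \<open>q\<close>. It would be central.\<close>

lemma moved_centralizer_exists:
  assumes fin: "finite (carrier G)" and Z: "center G = {\<one>}"
    and q: "prime q" "q dvd order G"
  obtains x y where "x \<in> carrier G" "x \<noteq> \<one>" "x [^] q = \<one>"
    "q ^ multiplicity q (order G) dvd card (centralizer G x)"
    "y \<in> carrier G" "centralizer G (conjg x y) \<noteq> centralizer G y"
proof -
  obtain x where x: "x \<in> carrier G" "x \<noteq> \<one>" "x [^] q = \<one>"
    "q ^ multiplicity q (order G) dvd card (centralizer G x)"
    using sylow_central_element[OF fin q] .
  have "\<exists>y\<in>carrier G. centralizer G (conjg x y) \<noteq> centralizer G y"
  proof (rule ccontr)
    assume "\<not> ?thesis"
    then have fixd: "\<And>b. b \<in> carrier G \<Longrightarrow> centralizer G (conjg x b) = centralizer G b" by blast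
    have "p ^ multiplicity p (order G) dvd card (centralizer G x)" if p: "prime p" for p
    proof (cases "p = q")
      case False
      obtain P where P: "subgroup P G" "card P = p ^ multiplicity p (order G)"
        using sylow_subgroup_exists[OF fin p] .
      have "P \<subseteq> centralizer G x"
      proof
        fix a assume a: "a \<in> P"
        show "a \<in> centralizer G x"
        proof (rule commute_if_centralizers_fixed_and_coprime[OF x(1,3) _ _ _ fixd])
          show "a [^] (p ^ multiplicity p (order G)) = \<one>"
            using subgroup_pow_card[OF P(1) a] P(2) by simp
          show "coprime q (p ^ multiplicity p (order G))"
            using p q(1) False by (simp add: primes_coprime)
        qed (use a P(1) subgroup.mem_carrier in auto)
      qed
      then show ?thesis using card_subgroup_dvd_card[OF P(1) subgroup_centralizer[OF x(1)]] P(2) by simp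
    qed (use x in simp)
    then have "x \<in> center G" using sylow_subgroups_centralize_imp_central[OF fin x(1)] by blast
    then show False using Z x by simp
  qed
  then show ?thesis using that x by blast
qed

section \<open>The lower bound\<close>

text \<open>A coincidence of two sets in the list makes \<open>S\<close> stable under some \<open>x\<^sup>d\<close> with \<open>d\<close> prime to \<open>q\<close>;
  but \<open>x\<close> is itself a power of \<open>x\<^sup>d\<close>.\<close>

lemma inj_on_prime_orbit:
  fixes q :: nat
  assumes x: "x \<in> carrier G" "x [^] q = \<one>" and q: "prime q"
    and S: "S \<subseteq> carrier G" and moved: "conjg x ` S \<noteq> S"
  shows "inj_on (\<lambda>i. conjg (x [^] i) ` S) {..<q}"
proof -
  have ne: "conjg (x [^] i) ` S \<noteq> conjg (x [^] j) ` S" if ij: "i < j" "j < q" for i j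
  proof
    assume eq: "conjg (x [^] i) ` S = conjg (x [^] j) ` S"
    define d where "d = j - i"
    have "x [^] j = x [^] i \<otimes> x [^] d" using x ij by (simp add: nat_pow_mult d_def)
    then have "conjg (x [^] i) ` S = conjg (x [^] i) ` conjg (x [^] d) ` S"
      using eq x S by (simp add: conjg_image_conjg_image)
    then have d: "conjg (x [^] d) ` S = S"
      using x S conjg_image_cancel[of "x [^] i" S "conjg (x [^] d) ` S"]
      by (simp add: conjg_image_closed)
    have dk: "conjg (x [^] (d * k)) ` S = S" for k
    proof (induction k)
      case 0 then show ?case using S by (simp add: conjg_image_by_one)
    next
      case (Suc k)
      have "x [^] (d * Suc k) = x [^] d \<otimes> x [^] (d * k)" using x by (simp add: nat_pow_mult)
      then have "conjg (x [^] (d * Suc k)) ` S = conjg (x [^] d) ` conjg (x [^] (d * k)) ` S"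
        using x S by (simp add: conjg_image_conjg_image)
      then show ?case using Suc d by simp
    qed
    have "\<not> q dvd d" using ij by (metis d_def diff_is_0_eq dvd_imp_le less_imp_diff_less not_le zero_less_diff)
    then have "coprime d q" using q by (metis prime_imp_coprime coprime_commute)
    then obtain k where "[d * k = 1] (mod q)" using cong_solve_coprime_nat by auto
    then have "x [^] (d * k) = x [^] (1::nat)"
      using x pow_mod_eq[of x q "d * k"] pow_mod_eq[of x q 1] by (simp add: cong_def)
    then have "conjg x ` S = S" using dk[of k] x by simp
    with moved show False ..
  qed
  show ?thesis
    by (rule linorder_inj_onI) (use ne in \<open>auto\<close>)
qed


lemma conjg_image_carrier: "g \<in> carrier G \<Longrightarrow> conjg g ` carrier G = carrier G"
  using conjg_inv_conjg(2)[of g] by (auto intro!: image_eqI[of a "conjg g" "conjg (inv g) a" for a])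

text \<open>The \<open>q\<close> conjugates of \<open>C(y)\<close> under powers of \<open>x\<close> form one orbit of length \<open>q\<close>; the whole group and
  \<open>C(x)\<close> are fixed by conjugation with \<open>x\<close>, so neither belongs to it.\<close>

lemma card_prime_orbit_of_centralizers:
  fixes q :: nat
  assumes Z: "center G = {\<one>}" and q: "prime q"
    and x: "x \<in> carrier G" "x \<noteq> \<one>" "x [^] q = \<one>"
    and y: "y \<in> carrier G" "centralizer G (conjg x y) \<noteq> centralizer G y"
  defines "L \<equiv> insert (carrier G) (insert (centralizer G x)
                  ((\<lambda>i. conjg (x [^] i) ` centralizer G y) ` {..<q}))"
  shows "L \<subseteq> Cent G" "card L = q + 2"
proof -
  define S where "S = centralizer G y"
  define F where "F = (\<lambda>i::nat. conjg (x [^] i) ` S)"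
  have S: "S \<subseteq> carrier G" by (simp add: S_def centralizer_subset)
  have F: "F i = centralizer G (conjg (x [^] i) y)" for i
    using x y by (simp add: F_def S_def centralizer_conjg)
  have moved: "conjg x ` S \<noteq> S" using x y by (simp add: S_def centralizer_conjg)
  have L: "L = insert (carrier G) (insert (centralizer G x) (F ` {..<q}))"
    by (simp add: L_def F_def S_def)
  show "L \<subseteq> Cent G"
    using x y centralizer_one unfolding L Cent_def by (auto simp: F intro: image_eqI[of _ _ \<one>])
  have inj: "inj_on F {..<q}"
    using inj_on_prime_orbit[OF x(1,3) q S moved] by (simp add: F_def)
  have ne1: "F i \<noteq> carrier G" for i
  proof
    assume "F i = carrier G"
    then have "conjg (x [^] i) ` S = conjg (x [^] i) ` carrier G"
      using x by (simp add: F_def conjg_image_carrier)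
    then have "S = carrier G" using x S by (subst (asm) conjg_image_cancel) auto
    then show False using moved x conjg_image_carrier by simp
  qed
  have ne2: "F i \<noteq> centralizer G x" for i
  proof
    assume Fi: "F i = centralizer G x"
    have "conjg x ` centralizer G x = centralizer G x"
      using x centralizer_conjg[of x x] by (simp add: conjg_def m_assoc)
    then have "conjg x ` conjg (x [^] i) ` S = conjg (x [^] i) ` S" using Fi by (simp add: F_def)
    moreover have "x \<otimes> x [^] i = x [^] i \<otimes> x" using x by (metis nat_pow_Suc nat_pow_Suc2)
    ultimately have "conjg (x [^] i) ` conjg x ` S = conjg (x [^] i) ` S"
      using x S by (simp add: conjg_image_conjg_image)
    then have "conjg x ` S = S"
      using x S by (subst (asm) conjg_image_cancel) (auto simp: conjg_image_closed)
    with moved show False ..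
  qed
  have ne3: "centralizer G x \<noteq> carrier G" using Z x in_center by auto
  have "carrier G \<notin> insert (centralizer G x) (F ` {..<q})" using ne1 ne3 by blast
  moreover have "centralizer G x \<notin> F ` {..<q}" using ne2 by blast
  ultimately show "card L = q + 2" unfolding L using card_image[OF inj] by simp
qed

lemma card_Cent_ge:
  fixes q :: nat
  assumes fin: "finite (carrier G)" and Z: "center G = {\<one>}" and q: "prime q" "q dvd order G"
  shows "card (Cent G) \<ge> q + 2"
proof -
  obtain x y where "x \<in> carrier G" "x \<noteq> \<one>" "x [^] q = \<one>"
    "y \<in> carrier G" "centralizer G (conjg x y) \<noteq> centralizer G y"
    using moved_centralizer_exists[OF fin Z q] by metis
  from card_prime_orbit_of_centralizers[OF Z q(1) this] show ?thesis
    using fin by (metis Cent_def card_mono finite_imageI)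
qed

section \<open>Frobenius groups with kernel of prime order\<close>

lemma cyclic_subgroupI:
  assumes H: "subgroup H G" and g: "g \<in> H" and gen: "\<And>h. h \<in> H \<Longrightarrow> \<exists>n::nat. h = g [^] n"
  shows "cyclic_group (G\<lparr>carrier := H\<rparr>)"
proof -
  interpret H: group "G\<lparr>carrier := H\<rparr>" using H by (rule subgroup_imp_group)
  have "h \<in> range (\<lambda>n::int. g [^]\<^bsub>G\<lparr>carrier := H\<rparr>\<^esub> n)" if h: "h \<in> H" for h
  proof -
    obtain n :: nat where "h = g [^] n" using gen[OF h] by blast
    then have "h = g [^]\<^bsub>G\<lparr>carrier := H\<rparr>\<^esub> int n" by (simp add: int_pow_int nat_pow_def)
    then show ?thesis by blast
  qed
  moreover have "g [^]\<^bsub>G\<lparr>carrier := H\<rparr>\<^esub> n \<in> H" for n :: int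
    using H.int_pow_closed[of g n] g by simp
  ultimately have "H = range (\<lambda>n::int. g [^]\<^bsub>G\<lparr>carrier := H\<rparr>\<^esub> n)" by blast
  then show ?thesis using g by (auto simp: H.cyclic_group)
qed

text \<open>Abstractly, the group acts faithfully on a cyclic group of order \<open>q\<close>, hence embeds into the cyclic
  group of units modulo \<open>q\<close>. Concretely, with a primitive root \<open>a\<close>, every \<open>h\<close> sends \<open>x\<close> to \<open>x\<close> raised to
  some \<open>a\<^sup>i\<close>. The exponents \<open>i\<close> that occur are the multiples of the least positive one \<open>d\<close>, by division
  with remainder, and an element realising \<open>d\<close> generates.\<close>

lemma faithful_on_prime_order_imp_cyclic:
  fixes q :: nat
  assumes x: "x \<in> carrier G" "x \<noteq> \<one>" "x [^] q = \<one>" and q: "prime q"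
    and H: "subgroup H G"
    and norm: "\<And>h. h \<in> H \<Longrightarrow> \<exists>n::nat. conjg h x = x [^] n"
    and faithful: "\<And>h. h \<in> H \<Longrightarrow> conjg h x = x \<Longrightarrow> h = \<one>"
  shows "cyclic_group (G\<lparr>carrier := H\<rparr>)"
proof -
  note HG = subgroup.mem_carrier[OF H]
  obtain a where a: "a \<in> {1..q - 1}" and gen: "{1..q - 1} = {a ^ i mod q | i. i \<in> UNIV}"
    using residue_prime_mult_group_has_gen[OF q] by blast
  have expo: "\<exists>i. conjg h x = x [^] (a ^ i)" if h: "h \<in> H" for h
  proof -
    obtain n :: nat where n: "conjg h x = x [^] n" using norm[OF h] by blast
    have "n mod q \<noteq> 0"
    proof
      assume "n mod q = 0"
      then have "x [^] n = \<one>" using pow_mod_eq[OF x(1,3), of n] by simp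
      then have "conjg h x = conjg h \<one>" using n HG[OF h] by simp
      then show False using HG[OF h] x by (subst (asm) conjg_eq_iff) auto
    qed
    moreover have "n mod q < q" using q prime_gt_0_nat by simp
    ultimately have "n mod q \<in> {1..q - 1}" by auto
    then obtain i where "n mod q = a ^ i mod q" unfolding gen by blast
    then show ?thesis using n pow_mod_eq[OF x(1,3)] by metis
  qed
  define P where "P = (\<lambda>d. d > 0 \<and> (\<exists>h\<in>H. conjg h x = x [^] (a ^ d)))"
  \<comment> \<open>By Fermat, the identity provides a positive exponent, so a least one exists.\<close>
  have "P (q - 1)"
  proof -
    have "\<not> q dvd a" using a by (auto dest: dvd_imp_le)
    then have "a ^ (q - 1) mod q = 1 mod q"
      using fermat_theorem[OF q] by (simp add: cong_def)
    then have "x [^] (a ^ (q - 1)) = x [^] (1::nat)"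
      using pow_mod_eq[OF x(1,3)] by metis
    then show ?thesis
      using x q subgroup.one_closed[OF H] prime_gt_1_nat[OF q]
      unfolding P_def by (metis conjg_by_one nat_pow_eone zero_less_diff)
  qed
  define d where "d = (LEAST d. P d)"
  have "P d" unfolding d_def using \<open>P (q - 1)\<close> by (rule LeastI)
  then obtain g where d: "d > 0" and g: "g \<in> H" "conjg g x = x [^] (a ^ d)"
    unfolding P_def by blast
  have gG: "g \<in> carrier G" using HG g by blast
  have gk: "conjg (g [^] k) x = x [^] (a ^ (d * k))" for k :: nat
  proof (induction k)
    case 0 then show ?case using x by simp
  next
    case (Suc k)
    have "conjg (g [^] Suc k) x = conjg (g [^] k) (x [^] (a ^ d))"
      using gG x g(2) by (simp flip: conjg_conjg)
    also have "\<dots> = x [^] (a ^ (d * Suc k))"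
      using Suc gG x by (simp add: conjg_pow nat_pow_pow power_add mult.commute)
    finally show ?case .
  qed
  have "\<exists>n::nat. h = g [^] n" if h: "h \<in> H" for h
  proof -
    obtain i where i: "conjg h x = x [^] (a ^ i)" using expo[OF h] by blast
    define u where "u = g [^] (i div d)"
    define h' where "h' = inv u \<otimes> h"
    have uH: "u \<in> H" using subgroup_nat_pow_closed[OF H g(1)] by (simp add: u_def)
    note uG = HG[OF uH] and hG = HG[OF h]
    have h'H: "h' \<in> H" using uH h H by (simp add: h'_def subgroup.m_closed subgroup.m_inv_closed)
    have "a ^ i = a ^ (d * (i div d)) * a ^ (i mod d)" by (simp flip: power_add)
    then have "conjg h x = conjg u x [^] (a ^ (i mod d))"
      using i gk[of "i div d"] x by (simp add: u_def nat_pow_pow)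
    then have "conjg h' x = conjg (inv u) (conjg u x [^] (a ^ (i mod d)))"
      using uG hG x by (simp add: h'_def flip: conjg_conjg)
    then have h'x: "conjg h' x = x [^] (a ^ (i mod d))"
      using uG x by (simp add: conjg_pow)
    have "i mod d = 0"
    proof (rule ccontr)
      assume "i mod d \<noteq> 0"
      then have "P (i mod d)" using h'x h'H unfolding P_def by blast
      then have "d \<le> i mod d" unfolding d_def by (rule Least_le)
      then show False using mod_less_divisor[OF d, of i] by linarith
    qed
    then have "conjg h' x = x" using h'x x by simp
    then have "inv u \<otimes> h = \<one>" using faithful[OF h'H] by (simp add: h'_def)
    then have "h = u" using uG hG by (metis inv_equality inv_inv inv_closed)
    then show ?thesis by (auto simp: u_def)
  qed
  then show ?thesis using cyclic_subgroupI[OF H g(1)] by blast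
qed

lemma conjg_image_self:
  assumes H: "subgroup H G" and h: "h \<in> H"
  shows "conjg h ` H = H"
proof -
  have cl: "conjg k ` H \<subseteq> H" if "k \<in> H" for k
    using that H unfolding conjg_def
    by (auto simp: subgroup.m_closed subgroup.m_inv_closed)
  note HG = subgroup.mem_carrier[OF H]
  have "a \<in> conjg h ` H" if a: "a \<in> H" for a
  proof (rule image_eqI)
    show "a = conjg h (conjg (inv h) a)" using a h HG by simp
    show "conjg (inv h) a \<in> H" using cl[of "inv h"] a h H by (auto simp: subgroup.m_inv_closed)
  qed
  then show ?thesis using cl[OF h] by blast
qed

lemma inj_on_mult_trivial_Int:
  assumes K: "subgroup K G" and H: "subgroup H G" and KH: "K \<inter> H = {\<one>}"
  shows "inj_on (\<lambda>(k, h). k \<otimes> h) (K \<times> H)"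
proof -
  interpret group_disjoint_sum G K H
    using K H by (intro group_disjoint_sum.intro) (auto intro: is_group)
  have "K \<inter> H \<subseteq> {\<one>}" using KH by simp
  then show ?thesis using cancel by (force simp: inj_on_def)
qed

lemma powers_of_prime_order:
  fixes q :: nat
  assumes x: "x \<in> carrier G" "x \<noteq> \<one>" "x [^] q = \<one>" and q: "prime q"
  shows "card ((\<lambda>i. x [^] i) ` {..<q}) = q"
    and "x [^] (n::nat) \<in> (\<lambda>i. x [^] i) ` {..<q}"
proof -
  have "ord x dvd q" using x pow_eq_id by blast
  moreover have "ord x \<noteq> 1" using x ord_eq_1 by blast
  ultimately have "ord x = q" using q prime_nat_iff by blast
  moreover have "{..<q} = {0..q - 1}" using prime_gt_0_nat[OF q] by auto
  ultimately show "card ((\<lambda>i. x [^] i) ` {..<q}) = q"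
    using ord_inj[OF x(1)] prime_gt_0_nat[OF q] by (simp add: card_image)
  show "x [^] n \<in> (\<lambda>i. x [^] i) ` {..<q}"
    using pow_mod_eq[OF x(1,3), of n] prime_gt_0_nat[OF q]
    by (metis image_eqI lessThan_iff mod_less_divisor)
qed

text \<open>The subgroup \<open>H\<close> is cyclic because it acts faithfully on \<open>C(x)\<close>. For the complement property, it is
  enough to conjugate by elements \<open>k\<close> of the normal factor \<open>C(x)\<close>: if \<open>u\<close> and \<open>v\<close> are in \<open>H\<close> and \<open>u\<close> is
  the conjugate of \<open>v\<close> by \<open>k\<close>, then \<open>u v\<^sup>-\<^sup>1\<close> lies in the trivial intersection of \<open>C(x)\<close> and \<open>H\<close>. So
  \<open>u = v\<close> commutes with \<open>k\<close>, therefore with \<open>x\<close> unless \<open>k = 1\<close>, and is trivial.\<close>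

lemma frobenius_cyclic_semidirectI:
  fixes q :: nat
  assumes fin: "finite (carrier G)" and q: "prime q"
    and x: "x \<in> carrier G" "x \<noteq> \<one>" "x [^] q = \<one>"
    and cen: "centralizer G x = (\<lambda>i. x [^] i) ` {..<q}"
    and nor: "\<And>g. g \<in> carrier G \<Longrightarrow> conjg g x \<in> centralizer G x"
    and H: "subgroup H G" and H1: "H \<noteq> {\<one>}" and KH: "centralizer G x \<inter> H = {\<one>}"
    and gen: "centralizer G x <#> H = carrier G"
    and cover: "carrier G = centralizer G x \<union> (\<Union>i<q. conjg (x [^] i) ` H)"
  shows "is_frobenius_cyclic_semidirect G q (card H)"
proof -
  define K where "K = centralizer G x"
  have K: "subgroup K G" using x by (simp add: K_def subgroup_centralizer)
  note KG = subgroup.mem_carrier[OF K] and HG = subgroup.mem_carrier[OF H]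
  have Kpow: "\<exists>i<q. k = x [^] i" if "k \<in> K" for k using that cen by (auto simp: K_def)
  have xK: "x \<in> K" using x by (simp add: K_def in_centralizer_self)
  have one: "k = \<one>" if "k \<in> K" "k \<in> H" for k using that KH by (auto simp: K_def)
  have norK: "conjg g k \<in> K" if g: "g \<in> carrier G" and k: "k \<in> K" for g k
  proof -
    obtain i where "k = x [^] (i::nat)" using Kpow[OF k] by blast
    then show ?thesis
      using g x nor[OF g] K subgroup_nat_pow_closed by (auto simp: conjg_pow K_def)
  qed
  have "K \<lhd> G" using K norK by (auto simp: normal_inv_iff conjg_def)
  then have semidirect: "is_semidirect_product G K H"
    using H KH gen by (simp add: is_semidirect_product_def K_def)
  have "cyclic_group (G\<lparr>carrier := K\<rparr>)"
    using cyclic_subgroupI[OF K xK] Kpow by blast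
  moreover have "card K = q" using powers_of_prime_order(1)[OF x q] cen by (simp add: K_def)
  moreover have "finite K" using cen by (simp add: K_def)
  ultimately have Kcyc: "cyclic_subgroup_of_order G q K"
    using K by (simp add: cyclic_subgroup_of_order_def)
  have fix_imp: "h = \<one>" if h: "h \<in> H" and hx: "conjg h x = x" for h
  proof (rule one[OF _ h])
    show "h \<in> K" using HG[OF h] hx x by (simp add: K_def in_centralizer_iff_conjg)
  qed
  have "cyclic_group (G\<lparr>carrier := H\<rparr>)"
  proof (rule faithful_on_prime_order_imp_cyclic[OF x q H _ fix_imp])
    fix h assume "h \<in> H"
    then have "conjg h x \<in> K" using HG xK norK by blast
    then show "\<exists>n::nat. conjg h x = x [^] n" using Kpow by blast
  qed
  moreover have "finite H" using fin H by (meson finite_subset subgroup.subset)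
  ultimately have Hcyc: "cyclic_subgroup_of_order G (card H) H"
    using H by (simp add: cyclic_subgroup_of_order_def)
  have disj: "H \<inter> conjugate_set G g H = {\<one>}" if g: "g \<in> carrier G - H" for g
  proof -
    obtain k h where k: "k \<in> K" and h: "h \<in> H" and gkh: "g = k \<otimes> h"
      using g gen[folded K_def] unfolding set_mult_def by blast
    have "conjg g ` H = conjg k ` conjg h ` H"
      using gkh KG[OF k] HG[OF h] subgroup.subset[OF H] by (simp add: conjg_image_conjg_image)
    then have gk: "conjg g ` H = conjg k ` H" using conjg_image_self[OF H h] by simp
    have k1: "k \<noteq> \<one>" using gkh g h HG[OF h] by auto
    have "u = \<one>" if u: "u \<in> H" "u \<in> conjg k ` H" for u
    proof -
      obtain v where v: "v \<in> H" "u = conjg k v" using u by blast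
      note G = KG[OF k] HG[OF v(1)] HG[OF u(1)]
      have "u \<otimes> inv v = k \<otimes> conjg v (inv k)" using v G by (simp add: conjg_def m_assoc)
      moreover have "k \<otimes> conjg v (inv k) \<in> K"
        using norK[of v "inv k"] G k K by (simp add: subgroup.m_closed subgroup.m_inv_closed)
      moreover have "u \<otimes> inv v \<in> H" using u v H by (simp add: subgroup.m_closed subgroup.m_inv_closed)
      ultimately have "u \<otimes> inv v = \<one>" using one by simp
      then have "u = v" using G by (metis inv_equality inv_inv inv_closed)
      then have "conjg k v = v" using v by simp
      then have vk: "conjg v k = k" using G by (simp add: conjg_fixes_iff)
      \<comment> \<open>As \<open>k\<close> is a non-trivial power of \<open>x\<close>, conversely \<open>x\<close> is a power of \<open>k\<close>.\<close>
      obtain i where i: "i < q" "k = x [^] i" using Kpow[OF k] by blast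
      have "i \<noteq> 0" using i k1 by (cases i) auto
      then have "\<not> q dvd i" using i by (auto dest: dvd_imp_le)
      then have "coprime i q" using q by (metis prime_imp_coprime coprime_commute)
      then obtain j where "[i * j = 1] (mod q)" using cong_solve_coprime_nat by auto
      then have "x [^] (i * j) = x [^] (1::nat)"
        using pow_mod_eq[OF x(1,3)] by (metis cong_def)
      then have "x = k [^] j" using i x by (simp add: nat_pow_pow)
      then have "conjg v x = x" using vk G by (simp add: conjg_pow)
      then have "v = \<one>" using fix_imp v by blast
      then show ?thesis using \<open>u = v\<close> by simp
    qed
    moreover have "\<one> \<in> conjg k ` H"
      using subgroup.one_closed[OF H] KG[OF k] by (auto intro!: image_eqI[of _ _ \<one>])
    ultimately have "H \<inter> conjg k ` H = {\<one>}" using subgroup.one_closed[OF H] by blast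
    then show ?thesis by (simp only: conjugate_set_eq_conjg_image gk)
  qed
  have "x \<notin> H" using one[OF xK] x by blast
  then have compl: "frobenius_complement G H"
    using H H1 x disj by (auto simp: frobenius_complement_def)
  have "K = frobenius_kernel G H"
  proof
    show "K \<subseteq> frobenius_kernel G H"
    proof
      fix k assume k: "k \<in> K"
      have "k = \<one>" if g: "g \<in> carrier G" and kg: "k \<in> conjg g ` H" for g
      proof -
        obtain v where v: "v \<in> H" "k = conjg g v" using kg by blast
        then have "v = conjg (inv g) k" using g HG by simp
        then have "v = \<one>" using one v(1) norK[of "inv g" k] g k by simp
        then show ?thesis using v g by simp
      qed
      then show "k \<in> frobenius_kernel G H"
        using KG[OF k] by (auto simp: frobenius_kernel_def conjugate_set_eq_conjg_image)
    qed
    show "frobenius_kernel G H \<subseteq> K"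
    proof
      fix k assume k: "k \<in> frobenius_kernel G H"
      show "k \<in> K"
      proof (rule ccontr)
        assume nk: "k \<notin> K"
        then have "k \<in> carrier G" "\<forall>g\<in>carrier G. k \<notin> conjg g ` H"
          using k subgroup.one_closed[OF K]
          by (auto simp: frobenius_kernel_def conjugate_set_eq_conjg_image)
        moreover obtain i where "k \<in> conjg (x [^] (i::nat)) ` H"
          using cover nk \<open>k \<in> carrier G\<close> unfolding K_def by blast
        ultimately show False using x by blast
      qed
    qed
  qed
  then show ?thesis
    using Kcyc Hcyc semidirect compl unfolding is_frobenius_cyclic_semidirect_def by blast
qed

section \<open>Groups attaining the lower bound\<close>

text \<open>When there are only \<open>q + 2\<close> centralizers, the orbit of \<open>H = C(y)\<close> together with \<open>K = C(x)\<close> accounts for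
  all proper ones. An element of \<open>K \<inter> H\<close> commutes with both \<open>x\<close> and \<open>y\<close>, and no proper centralizer
  contains both; so \<open>K \<inter> H\<close> is trivial and \<open>|K| |H| \<le> |G|\<close>. As every non-trivial element lies in its own
  centralizer, which is proper, the group is the union of \<open>K\<close> and the \<open>q\<close> conjugates of \<open>H\<close>, whence
  \<open>|G| \<le> |K| + q (|H| - 1)\<close>. Comparison gives \<open>|K| \<le> q\<close>, so \<open>K\<close> consists of the powers of \<open>x\<close>, and
  \<open>|G| = q |H|\<close>, so \<open>G = K H\<close>. Finally \<open>K\<close> contains a Sylow \<open>q\<close>-subgroup, so \<open>q\<close> does not divide \<open>|H|\<close>; a
  conjugate of \<open>x\<close> cannot lie in a conjugate of \<open>H\<close>, and must lie in \<open>K\<close>, which is therefore normal.\<close>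

lemma card_Cent_eq_imp_frobenius:
  fixes q :: nat
  assumes fin: "finite (carrier G)" and Z: "center G = {\<one>}" and q: "prime q" "q dvd order G"
    and eq: "card (Cent G) = q + 2"
  shows "\<exists>n>0. is_frobenius_cyclic_semidirect G q n"
proof -
  obtain x y where x: "x \<in> carrier G" "x \<noteq> \<one>" "x [^] q = \<one>"
    and sylow: "q ^ multiplicity q (order G) dvd card (centralizer G x)"
    and y: "y \<in> carrier G" and moved: "centralizer G (conjg x y) \<noteq> centralizer G y"
    using moved_centralizer_exists[OF fin Z q] by metis
  define K where "K = centralizer G x"
  define H where "H = centralizer G y"
  define F where "F = (\<lambda>i::nat. conjg (x [^] i) ` H)"
  have KG: "K \<subseteq> carrier G" and HG: "H \<subseteq> carrier G"
    by (simp_all add: K_def H_def centralizer_subset)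
  have K: "subgroup K G" and H: "subgroup H G"
    using x y by (simp_all add: K_def H_def subgroup_centralizer)
  have finK: "finite K" and finH: "finite H"
    using KG HG fin finite_subset by blast+
  have q0: "q > 0" using q(1) prime_gt_0_nat by blast
  have Cent: "Cent G = insert (carrier G) (insert K (F ` {..<q}))"
    using card_prime_orbit_of_centralizers[OF Z q(1) x y moved] eq fin
    unfolding K_def H_def F_def
    by (metis Cent_def card_subset_eq finite_imageI)
  have proper: "centralizer G g \<in> insert K (F ` {..<q})" if "g \<in> carrier G" "g \<noteq> \<one>" for g
  proof -
    have "centralizer G g \<noteq> carrier G" using that Z in_center by auto
    moreover have "centralizer G g \<in> Cent G" using that by (simp add: Cent_def)
    ultimately show ?thesis using Cent by blast
  qed
  have xy: "conjg x y \<noteq> y" using moved by auto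
  have yK: "y \<notin> K"
    using xy x y in_centralizer_swap[of x y] in_centralizer_iff_conjg[of y x] unfolding K_def by blast
  have xH: "x \<notin> H" using xy y in_centralizer_iff_conjg[of y x] unfolding H_def by blast
  have xF: "x \<notin> F i" for i
  proof
    assume "x \<in> F i"
    then obtain u where u: "u \<in> H" "x = conjg (x [^] i) u" unfolding F_def by blast
    have "x [^] i \<in> centralizer G x"
      using subgroup_nat_pow_closed[OF subgroup_centralizer in_centralizer_self] x by blast
    then have "conjg (x [^] i) x = conjg (x [^] i) u"
      using u(2) x by (simp add: in_centralizer_iff_conjg)
    then have "x = u" using x u(1) HG by (subst (asm) conjg_eq_iff) auto
    then show False using u xH by simp
  qed
  have KH: "K \<inter> H = {\<one>}"
  proof -
    have "g = \<one>" if g: "g \<in> K" "g \<in> H" for g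
    proof (rule ccontr)
      assume "g \<noteq> \<one>"
      then have "centralizer G g \<in> insert K (F ` {..<q})" using proper g(1) KG by blast
      moreover have "x \<in> centralizer G g" using in_centralizer_swap[OF x(1)] g(1) by (simp add: K_def)
      moreover have "y \<in> centralizer G g" using in_centralizer_swap[OF y] g(2) by (simp add: H_def)
      ultimately show False using yK xF by blast
    qed
    then show ?thesis using K H by (auto simp: subgroup.one_closed)
  qed
  have cover: "carrier G = K \<union> (\<Union>i<q. F i)"
  proof
    show "carrier G \<subseteq> K \<union> (\<Union>i<q. F i)"
    proof
      fix g assume g: "g \<in> carrier G"
      show "g \<in> K \<union> (\<Union>i<q. F i)"
        using proper[OF g] in_centralizer_self[OF g] subgroup.one_closed[OF K] by (cases "g = \<one>") auto
    qed
    show "K \<union> (\<Union>i<q. F i) \<subseteq> carrier G"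
      using KG conjg_image_closed[OF nat_pow_closed[OF x(1)] HG] unfolding F_def by blast
  qed
  have cardF: "card (F i) = card H" for i using x HG by (simp add: F_def card_conjg_image)
  have oneF: "\<one> \<in> F i" for i
    using subgroup.one_closed[OF H] x by (auto simp: F_def intro!: image_eqI[of _ _ \<one>])
  have finF: "finite (F i)" for i using finH by (simp add: F_def)
  \<comment> \<open>The identity is shared by \<open>K\<close> and all conjugates of \<open>H\<close>, so each conjugate adds at most \<open>card H - 1\<close>.\<close>
  have upper: "order G \<le> card K + q * (card H - 1)"
  proof -
    have "carrier G = K \<union> (\<Union>i<q. F i - {\<one>})"
      using cover subgroup.one_closed[OF K] by auto
    then have "order G \<le> card K + card (\<Union>i<q. F i - {\<one>})"
      unfolding order_def by (metis card_Un_le)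
    also have "card (\<Union>i<q. F i - {\<one>}) \<le> (\<Sum>i<q. card (F i - {\<one>}))"
      by (rule card_UN_le) simp
    also have "\<dots> = q * (card H - 1)" using cardF oneF finF by simp
    finally show ?thesis by simp
  qed
  note inj = inj_on_mult_trivial_Int[OF K H KH]
  have img: "(\<lambda>(k, h). k \<otimes> h) ` (K \<times> H) = K <#> H"
    by (auto simp: set_mult_def)
  have KHG: "K <#> H \<subseteq> carrier G" using KG HG by (simp add: set_mult_closed)
  have cardKH: "card (K <#> H) = card K * card H"
    using card_image[OF inj] by (simp add: img card_cartesian_product)
  have lower: "card K * card H \<le> order G"
    using card_mono[OF fin KHG] cardKH by (simp add: order_def)
  have y1: "y \<noteq> \<one>" using xy x by auto
  have "{\<one>, y} \<subseteq> H" using y subgroup.one_closed[OF H] by (simp add: H_def in_centralizer_self)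
  then have "card {\<one>, y} \<le> card H" using finH by (rule card_mono[rotated])
  then have h2: "card H \<ge> 2" using y1 by simp
  then obtain m where m: "card H = Suc m" "m > 0" by (cases "card H") auto
  have "card K * m \<le> q * m" using order_trans[OF lower upper] by (simp add: m(1))
  then have Kq: "card K \<le> q" using m by simp
  have xK: "x [^] (n::nat) \<in> K" for n
    using subgroup_nat_pow_closed[OF subgroup_centralizer in_centralizer_self] x by (simp add: K_def)
  have Kpow: "K = (\<lambda>i. x [^] i) ` {..<q}"
    by (rule card_seteq[symmetric]) (use finK xK Kq powers_of_prime_order(1)[OF x q(1)] in auto)
  have Kq': "card K = q" using powers_of_prime_order(1)[OF x q(1)] Kpow by simp
  have ordG: "order G = q * card H" using lower upper m Kq' by simp
  then have gen: "K <#> H = carrier G"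
    using card_subset_eq[OF fin KHG] cardKH Kq' by (simp add: order_def)
  have nq: "\<not> q dvd card H"
  proof
    assume "q dvd card H"
    then have "q ^ 2 dvd order G" using ordG by (simp add: power2_eq_square)
    moreover have "order G \<noteq> 0" using fin by (simp add: order_def card_eq_0_iff carrier_not_empty)
    ultimately have "2 \<le> multiplicity q (order G)"
      using q(1) by (intro multiplicity_geI) (auto dest: not_prime_unit)
    then have "q ^ 2 dvd q" using sylow Kq' unfolding K_def by (metis le_imp_power_dvd dvd_trans)
    then show False using q0 prime_gt_1_nat[OF q(1)] by (auto dest!: dvd_imp_le simp: power2_eq_square)
  qed
  have normal: "conjg g x \<in> K" if g: "g \<in> carrier G" for g
  proof (rule ccontr)
    assume "conjg g x \<notin> K"
    moreover have "conjg g x \<in> carrier G" using g x by simp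
    ultimately obtain i where "conjg g x \<in> F i" using cover by blast
    then obtain u where u: "u \<in> H" "conjg g x = conjg (x [^] i) u" unfolding F_def by blast
    have uG: "u \<in> carrier G" using u(1) HG by blast
    have "u = conjg (inv (x [^] i)) (conjg g x)" unfolding u(2) using uG x by simp
    then have uc: "u = conjg (inv (x [^] i) \<otimes> g) x" using g x by (simp add: conjg_conjg)
    then have "u [^] q = \<one>" using g x by (simp flip: conjg_pow)
    then have "ord u dvd q" using uG pow_eq_id by blast
    moreover have "u \<noteq> \<one>"
      using uc g x conjg_eq_iff[of "inv (x [^] i) \<otimes> g" x \<one>] by auto
    then have "ord u \<noteq> 1" using uG ord_eq_1 by blast
    ultimately have "ord u = q" using q(1) prime_nat_iff by blast
    moreover have "ord u dvd card H" using subgroup_pow_card[OF H u(1)] uG pow_eq_id by blast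
    ultimately show False using nq by simp
  qed
  have "H \<noteq> {\<one>}" using h2 by auto
  then have "is_frobenius_cyclic_semidirect G q (card H)"
    using frobenius_cyclic_semidirectI[OF fin q(1) x] Kpow normal H KH gen cover
    unfolding K_def F_def by blast
  then show ?thesis using h2 by (intro exI[of _ "card H"]) simp
qed

lemma cyclic_subgroup_commutes:
  assumes "cyclic_subgroup_of_order G m K" "a \<in> K" "b \<in> K"
  shows "a \<otimes> b = b \<otimes> a"
proof -
  have K: "subgroup K G" "cyclic_group (G\<lparr>carrier := K\<rparr>)"
    using assms by (auto simp: cyclic_subgroup_of_order_def)
  interpret K: comm_group "G\<lparr>carrier := K\<rparr>"
    using group.cyclic_imp_abelian_group[OF subgroup_imp_group[OF K(1)] K(2)] .
  show ?thesis using K.m_comm assms by simp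
qed

text \<open>In a Frobenius group with abelian kernel \<open>K\<close> and abelian complement \<open>H\<close>, the centralizer of a
  non-trivial element is \<open>K\<close> or a conjugate of \<open>H\<close>. Since \<open>G = K H\<close>, elements of \<open>K\<close> suffice to
  conjugate \<open>H\<close>, so \<open>H\<close> has at most \<open>|K|\<close> conjugates.\<close>

lemma frobenius_cyclic_card_Cent_le:
  fixes q n :: nat
  assumes fin: "finite (carrier G)" and frob: "is_frobenius_cyclic_semidirect G q n"
  shows "card (Cent G) \<le> q + 2"
proof -
  obtain K H where Kc: "cyclic_subgroup_of_order G q K" and Hc: "cyclic_subgroup_of_order G n H"
    and sd: "is_semidirect_product G K H" and fc: "frobenius_complement G H"
    and ker: "K = frobenius_kernel G H"
    using frob unfolding is_frobenius_cyclic_semidirect_def by blast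
  have K: "subgroup K G" "card K = q" "finite K" and H: "subgroup H G"
    using Kc Hc by (auto simp: cyclic_subgroup_of_order_def)
  note KG = subgroup.mem_carrier[OF K(1)] and HG = subgroup.mem_carrier[OF H]
  have KH: "K \<inter> H = {\<one>}" and gen: "K <#> H = carrier G"
    using sd by (auto simp: is_semidirect_product_def)
  have decomp: "\<exists>k\<in>K. \<exists>h\<in>H. g = k \<otimes> h" if "g \<in> carrier G" for g
    using that gen unfolding set_mult_def by blast
  have free: "h = \<one>" if g: "g \<in> carrier G" "g \<notin> H" and h: "h \<in> H" and gh: "g \<otimes> h = h \<otimes> g" for g h
  proof -
    have "conjg g h = h" using conjg_fixes_iff g HG[OF h] gh by blast
    then have "h \<in> H \<inter> conjugate_set G g H"
      unfolding conjugate_set_eq_conjg_image using h by (metis IntI imageI)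
    moreover have "H \<inter> conjugate_set G g H = {\<one>}"
      using fc g unfolding frobenius_complement_def by blast
    ultimately show ?thesis by blast
  qed
  have cH: "centralizer G h = H" if h: "h \<in> H" "h \<noteq> \<one>" for h
  proof
    show "centralizer G h \<subseteq> H" using free[OF _ _ h(1)] h(2) unfolding in_centralizer subset_iff by blast
    show "H \<subseteq> centralizer G h"
      using cyclic_subgroup_commutes[OF Hc _ h(1)] HG by (auto simp: in_centralizer)
  qed
  have cK: "centralizer G k = K" if k: "k \<in> K" "k \<noteq> \<one>" for k
  proof
    show "K \<subseteq> centralizer G k"
      using cyclic_subgroup_commutes[OF Kc _ k(1)] KG by (auto simp: in_centralizer)
    show "centralizer G k \<subseteq> K"
    proof
      fix u assume u: "u \<in> centralizer G k"
      then have "u \<in> carrier G" by (simp add: in_centralizer)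
      then obtain c h where c: "c \<in> K" and h: "h \<in> H" and uch: "u = c \<otimes> h" using decomp by blast
      have "c \<in> centralizer G k" using \<open>K \<subseteq> centralizer G k\<close> c by blast
      then have "inv c \<otimes> u \<in> centralizer G k"
        using u subgroup_centralizer[OF KG[OF k(1)]] by (simp add: subgroup.m_closed subgroup.m_inv_closed)
      then have "h \<in> centralizer G k" using uch KG[OF c] HG[OF h] by (simp flip: m_assoc)
      moreover have "k \<notin> H" using k KH by blast
      ultimately have "h = \<one>" using free[OF KG[OF k(1)] _ h] by (simp add: in_centralizer)
      then show "u \<in> K" using uch c KG[OF c] by simp
    qed
  qed
  have "Cent G \<subseteq> insert (carrier G) (insert K ((\<lambda>k. conjg k ` H) ` K))"
  proof
    fix C assume "C \<in> Cent G"
    then obtain g where g: "g \<in> carrier G" and C: "C = centralizer G g" by (auto simp: Cent_def)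
    consider "g = \<one>" | "g \<in> K" "g \<noteq> \<one>" | "g \<notin> K" by blast
    then show "C \<in> insert (carrier G) (insert K ((\<lambda>k. conjg k ` H) ` K))"
    proof cases
      case 1
      then show ?thesis using C centralizer_one by simp
    next
      case 2
      then show ?thesis using C cK by simp
    next
      case 3
      then obtain a h where a: "a \<in> carrier G" and h: "h \<in> H" and gah: "g = conjg a h"
        using ker g by (auto simp: frobenius_kernel_def conjugate_set_eq_conjg_image)
      have "h \<noteq> \<one>" using 3 gah a subgroup.one_closed[OF K(1)] by auto
      then have Ca: "C = conjg a ` H" using C gah a h HG cH by (simp add: centralizer_conjg)
      obtain k b where k: "k \<in> K" and b: "b \<in> H" and akb: "a = k \<otimes> b" using decomp[OF a] by blast
      have "conjg a ` H = conjg k ` conjg b ` H"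
        using akb KG[OF k] HG[OF b] subgroup.subset[OF H] by (simp add: conjg_image_conjg_image)
      then show ?thesis using Ca k conjg_image_self[OF H b] by auto
    qed
  qed
  then have "card (Cent G) \<le> card (insert (carrier G) (insert K ((\<lambda>k. conjg k ` H) ` K)))"
    using K(3) by (intro card_mono) auto
  also have "\<dots> \<le> Suc (Suc (card ((\<lambda>k. conjg k ` H) ` K)))"
    using K(3) by (simp add: card_insert_if)
  also have "\<dots> \<le> q + 2" using card_image_le[OF K(3)] K(2) by simp
  finally show ?thesis .
qed

section \<open>The upper bound and groups attaining it\<close>

lemma centralizer_inv:
  assumes z: "z \<in> carrier G"
  shows "centralizer G (inv z) = centralizer G z"
proof -
  have "conjg g (inv z) = inv z \<longleftrightarrow> conjg g z = z" if "g \<in> carrier G" for g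
    using that z by (metis conjg_closed conjg_inv inv_inv)
  then show ?thesis using z by (auto simp: in_centralizer_iff_conjg)
qed

text \<open>A group in which every element is its own inverse is abelian.\<close>

lemma ex_not_self_inverse:
  assumes Z: "center G = {\<one>}" and nontriv: "carrier G \<noteq> {\<one>}"
  obtains z where "z \<in> carrier G" "inv z \<noteq> z"
proof -
  have "\<exists>z\<in>carrier G. inv z \<noteq> z"
  proof (rule ccontr)
    assume "\<not> ?thesis"
    then have inv: "inv z = z" if "z \<in> carrier G" for z using that by blast
    have "a \<otimes> b = b \<otimes> a" if "a \<in> carrier G" "b \<in> carrier G" for a b
      using that inv_mult_group[of a b] by (simp add: inv)
    then have "center G = carrier G" by (auto simp: center_def)
    with Z nontriv show False by simp
  qed
  then show ?thesis using that by blast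
qed

text \<open>As \<open>z\<close> and its inverse have the same centralizer, one of them can be left out.\<close>

lemma Cent_eq_image_Diff_inv:
  assumes "z \<in> carrier G" "inv z \<noteq> z"
  shows "Cent G = centralizer G ` (carrier G - {inv z})"
proof -
  have "centralizer G (inv z) \<in> centralizer G ` (carrier G - {inv z})"
    using assms centralizer_inv by (metis DiffI image_eqI singletonD)
  then show ?thesis by (auto simp: Cent_def)
qed

lemma card_Cent_less_order:
  assumes fin: "finite (carrier G)" and Z: "center G = {\<one>}" and nontriv: "carrier G \<noteq> {\<one>}"
  shows "card (Cent G) \<le> order G - 1"
proof -
  obtain z where z: "z \<in> carrier G" "inv z \<noteq> z" using ex_not_self_inverse[OF Z nontriv] .
  have "card (Cent G) \<le> card (carrier G - {inv z})"
    unfolding Cent_eq_image_Diff_inv[OF z] using fin by (intro card_image_le) simp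
  then show ?thesis using z by (simp add: order_def)
qed

text \<open>Every conjugate of \<open>z\<close> is \<open>z\<close> or its inverse. If \<open>z\<close> had order \<open>4\<close>, its square would be fixed by all
  conjugations, hence central; otherwise the square of \<open>z\<close> is again not self-inverse, which leaves
  order \<open>3\<close>. A further element \<open>u\<close> commuting with \<open>z\<close> would be an involution, and \<open>u z\<close>, of order \<open>6\<close>, would
  belong to another pair of mutually inverse elements.\<close>

lemma centralizer_of_unique_inverse_pair:
  assumes Z: "center G = {\<one>}"
    and z: "z \<in> carrier G" "inv z \<noteq> z"
    and only: "\<And>w. w \<in> carrier G \<Longrightarrow> inv w \<noteq> w \<Longrightarrow> w = z \<or> w = inv z"
  shows "centralizer G z = {\<one>, z, inv z}"
proof -
  have z1: "z \<noteq> \<one>" using z by auto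
  have cz: "conjg g z = z \<or> conjg g z = inv z" if g: "g \<in> carrier G" for g
  proof (rule only)
    show "inv (conjg g z) \<noteq> conjg g z"
      using g z by (simp flip: conjg_inv)
  qed (use g z in simp)
  have zz: "z \<otimes> z = inv z"
  proof (cases "inv (z \<otimes> z) = z \<otimes> z")
    case True
    have "conjg g (z \<otimes> z) = z \<otimes> z" if g: "g \<in> carrier G" for g
      using cz[OF g] g z True by (auto simp: conjg_mult inv_mult_group)
    then have "z \<otimes> z \<in> center G"
      using z by (auto simp: in_center in_centralizer_iff_conjg)
    then have "z \<otimes> z = \<one>" using Z by simp
    then have "inv z = z" using z inv_equality by blast
    with z(2) show ?thesis by simp
  next
    case False
    then have "z \<otimes> z = z \<or> z \<otimes> z = inv z" using only[of "z \<otimes> z"] z by simp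
    moreover have "z \<otimes> z \<noteq> z" using z z1 by (simp add: l_cancel_one)
    ultimately show ?thesis by blast
  qed
  show "centralizer G z = {\<one>, z, inv z}"
  proof
    show "centralizer G z \<subseteq> {\<one>, z, inv z}"
    proof
      fix u assume u: "u \<in> centralizer G z"
      then have uG: "u \<in> carrier G" and uz: "u \<otimes> z = z \<otimes> u" by (auto simp: in_centralizer)
      show "u \<in> {\<one>, z, inv z}"
      proof (rule ccontr)
        assume nu: "u \<notin> {\<one>, z, inv z}"
        then have "inv u = u" using only[OF uG] by blast
        then have uu: "u \<otimes> u = \<one>" using uG by (metis r_inv)
        have "inv (u \<otimes> z) = inv u \<otimes> inv z" using uG z uz by (simp add: inv_mult_group)
        then have "inv (u \<otimes> z) = u \<otimes> inv z" using \<open>inv u = u\<close> by simp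
        then have "inv (u \<otimes> z) \<noteq> u \<otimes> z" using uG z by simp
        then consider "u \<otimes> z = z" | "u \<otimes> z = inv z" using only[of "u \<otimes> z"] uG z by auto
        then show False
        proof cases
          case 1
          then show False using nu uG z by simp
        next
          case 2
          then have "u \<otimes> z = z \<otimes> z" using zz by simp
          then show False using nu uG z by simp
        qed
      qed
    qed
    show "{\<one>, z, inv z} \<subseteq> centralizer G z"
      using z by (simp add: in_centralizer)
  qed
qed

text \<open>The isomorphism is the permutation action on \<open>T\<close> by conjugation, transported to \<open>{1..n}\<close>; it is
  injective by faithfulness, so surjective by counting.\<close>

lemma iso_sym_groupI:
  assumes T: "T \<subseteq> carrier G" "card T = n" "finite T"
    and closed: "\<And>g t. g \<in> carrier G \<Longrightarrow> t \<in> T \<Longrightarrow> conjg g t \<in> T"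
    and faithful: "\<And>g. g \<in> carrier G \<Longrightarrow> (\<And>t. t \<in> T \<Longrightarrow> conjg g t = t) \<Longrightarrow> g = \<one>"
    and ord: "order G = fact n"
  shows "G \<cong> sym_group n"
proof -
  obtain b where b: "bij_betw b {1..n} T"
    using finite_same_card_bij[of "{1..n}" T] T by auto
  define c where "c = inv_into {1..n} b"
  have bT: "b i \<in> T" if "i \<in> {1..n}" for i using b that bij_betwE by blast
  have cb: "c (b i) = i" if "i \<in> {1..n}" for i
    using b that unfolding c_def by (simp add: bij_betw_inv_into_left)
  have bc: "b (c t) = t" if "t \<in> T" for t
    using b that unfolding c_def by (simp add: bij_betw_inv_into_right)
  have cT: "c t \<in> {1..n}" if "t \<in> T" for t
    using bij_betw_inv_into[OF b] that unfolding c_def by (meson bij_betwE)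
  note TG = subsetD[OF T(1)]
  define f where "f = (\<lambda>g i. if i \<in> {1..n} then c (conjg g (b i)) else i)"
  have f_in: "f g i = c (conjg g (b i))" if "i \<in> {1..n}" for g i using that by (simp add: f_def)
  have f_mult: "f (g \<otimes> h) = f g \<circ> f h" if g: "g \<in> carrier G" and h: "h \<in> carrier G" for g h
  proof
    fix i
    show "f (g \<otimes> h) i = (f g \<circ> f h) i"
    proof (cases "i \<in> {1..n}")
      case True
      note t = bT[OF True]
      show ?thesis
        using True g h t TG[OF t] closed[OF h t] cT[OF closed[OF h t]] bc[OF closed[OF h t]]
        by (simp add: f_in conjg_conjg)
    next
      case False
      then show ?thesis by (auto simp: f_def)
    qed
  qed
  have f_one: "f \<one> = id"
  proof
    fix i show "f \<one> i = id i"
      using bT[of i] TG[of "b i"] cb[of i] by (simp add: f_def)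
  qed
  have f_perm: "f g permutes {1..n}" if g: "g \<in> carrier G" for g
  proof (rule bij_imp_permutes)
    have "f g \<circ> f (inv g) = id" "f (inv g) \<circ> f g = id"
      using g f_mult[of g "inv g"] f_mult[of "inv g" g] f_one by simp_all
    then have inj: "inj (f g)" by (metis inj_on_id inj_on_imageI2)
    have "f g ` {1..n} \<subseteq> {1..n}"
      using cT closed[OF g bT] f_in by (metis image_subsetI)
    then have "f g ` {1..n} = {1..n}"
      using inj by (metis card_image card_subset_eq finite_atLeastAtMost inj_on_subset subset_UNIV)
    then show "bij_betw (f g) {1..n} {1..n}"
      using inj by (metis bij_betw_def inj_on_subset subset_UNIV)
  qed (simp add: f_def del: atLeastAtMost_iff)
  have hom: "f \<in> hom G (sym_group n)"
    by (rule homI) (simp_all only: sym_group_carrier sym_group_mult f_perm f_mult)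
  have "group_hom G (sym_group n) f"
    by (intro group_hom.intro group_hom_axioms.intro hom is_group sym_group_is_group)
  moreover have "g = \<one>" if g: "g \<in> carrier G" and fg: "f g = id" for g
  proof (rule faithful[OF g])
    fix t assume t: "t \<in> T"
    have "c (conjg g t) = c t"
      using fg f_in[OF cT[OF t], of g] bc[OF t] by simp
    then show "conjg g t = t" using bc[OF t] bc[OF closed[OF g t]] by metis
  qed
  then have "\<And>g. g \<in> carrier G \<Longrightarrow> f g = \<one>\<^bsub>sym_group n\<^esub> \<Longrightarrow> g = \<one>"
    by (simp add: sym_group_one)
  ultimately have inj: "inj_on f (carrier G)"
    by (auto simp: group_hom.inj_on_one_iff)
  have sub: "f ` carrier G \<subseteq> carrier (sym_group n)" using f_perm sym_group_carrier by blast
  have "card (carrier (sym_group n)) = fact n" by (rule sym_group_card_carrier)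
  moreover have "finite (carrier (sym_group n))"
    using calculation by (metis card.infinite fact_nonzero)
  ultimately have "f ` carrier G = carrier (sym_group n)"
    using card_subset_eq[OF _ sub] card_image[OF inj] ord by (simp add: order_def)
  then show ?thesis using hom inj by (auto simp: is_iso_def iso_def bij_betw_def)
qed

text \<open>The hypothesis says that \<open>z\<close> and its inverse form the only coincidence among centralizers of distinct
  elements, so every other element is its own inverse. Conjugation maps \<open>z\<close> to \<open>z\<close> or its inverse, so
  the centralizer of \<open>z\<close>, of order \<open>3\<close>, has index \<open>2\<close>. The group has order \<open>6\<close> and permutes its three
  involutions faithfully.\<close>

lemma many_centralizers_imp_sym_group_3:
  assumes fin: "finite (carrier G)" and Z: "center G = {\<one>}" and nontriv: "carrier G \<noteq> {\<one>}"
    and eq: "card (Cent G) = order G - 1"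
  shows "G \<cong> sym_group 3"
proof -
  obtain z where z: "z \<in> carrier G" "inv z \<noteq> z" using ex_not_self_inverse[OF Z nontriv] .
  have "card (centralizer G ` (carrier G - {inv z})) = card (carrier G - {inv z})"
    using eq z unfolding Cent_eq_image_Diff_inv[OF z] by (simp add: order_def)
  then have inj: "inj_on (centralizer G) (carrier G - {inv z})"
    using fin by (intro eq_card_imp_inj_on) auto
  have only: "w = z \<or> w = inv z" if w: "w \<in> carrier G" "inv w \<noteq> w" for w
  proof (rule ccontr)
    assume n: "\<not> (w = z \<or> w = inv z)"
    then have "inv w \<noteq> inv z" using w z by (metis inv_inv)
    then have "inv w = w"
      using inj_onD[OF inj centralizer_inv[OF w(1)]] n w by simp
    with w show False by simp
  qed
  have Cz: "centralizer G z = {\<one>, z, inv z}"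
    using centralizer_of_unique_inverse_pair[OF Z z] only by blast
  have z1: "z \<noteq> \<one>" using z by auto
  have iz1: "inv z \<noteq> \<one>" using z z1 by (metis inv_inv inv_one)
  have "z \<notin> center G" using z1 Z by simp
  then obtain s where s: "s \<in> carrier G" "conjg s z \<noteq> z"
    using z in_center in_centralizer_iff_conjg centralizer_subset by blast
  define T where "T = {t \<in> carrier G. t \<noteq> \<one> \<and> inv t = t}"
  have conj_z: "conjg g z = z \<or> conjg g z = inv z" if g: "g \<in> carrier G" for g
    by (rule only) (use g z in \<open>simp_all flip: conjg_inv\<close>)
  have split: "carrier G = T \<union> {\<one>, z, inv z}" using z only by (auto simp: T_def)
  have disj: "T \<inter> {\<one>, z, inv z} = {}" using z by (auto simp: T_def)
  \<comment> \<open>Elements outside the centralizer all act on \<open>z\<close> as \<open>s\<close> does, by inversion.\<close>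
  have coset: "(\<lambda>c. s \<otimes> c) ` centralizer G z = carrier G - centralizer G z"
  proof
    show "(\<lambda>c. s \<otimes> c) ` centralizer G z \<subseteq> carrier G - centralizer G z"
      using s z by (auto simp: in_centralizer_iff_conjg simp flip: conjg_conjg)
    show "carrier G - centralizer G z \<subseteq> (\<lambda>c. s \<otimes> c) ` centralizer G z"
    proof
      fix g assume g: "g \<in> carrier G - centralizer G z"
      then have "conjg g z = conjg s z"
        using conj_z[of g] conj_z[OF s(1)] s z by (auto simp: in_centralizer_iff_conjg)
      then have "conjg (inv s) (conjg g z) = z" using s z by simp
      then have "inv s \<otimes> g \<in> centralizer G z"
        using g s z by (simp add: in_centralizer_iff_conjg conjg_conjg)
      moreover have "g = s \<otimes> (inv s \<otimes> g)" using g s by (simp flip: m_assoc)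
      ultimately show "g \<in> (\<lambda>c. s \<otimes> c) ` centralizer G z" by blast
    qed
  qed
  have Tcoset: "T = (\<lambda>c. s \<otimes> c) ` {\<one>, z, inv z}"
    using coset split disj Cz by auto
  have c3: "card {\<one>, z, inv z} = 3" using z z1 iz1 by (metis card_3_iff)
  have "inj_on (\<lambda>c. s \<otimes> c) {\<one>, z, inv z}" using s z by (auto simp: inj_on_def)
  then have T3: "card T = 3" unfolding Tcoset using c3 by (simp only: card_image)
  have finT: "finite T" using fin by (simp add: T_def)
  have "order G = card T + card {\<one>, z, inv z}"
    unfolding order_def split using disj finT by (intro card_Un_disjoint) auto
  then have six: "order G = fact 3" using T3 c3 by (simp add: fact_numeral)
  have sT: "s \<in> T" "s \<otimes> z \<in> T" using Tcoset s by auto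
  show ?thesis
  proof (rule iso_sym_groupI[OF _ T3 finT _ _ six])
    show "T \<subseteq> carrier G" by (auto simp: T_def)
    show "conjg g t \<in> T" if "g \<in> carrier G" "t \<in> T" for g t
      using that conjg_eq_iff[of g t \<one>] by (auto simp: T_def simp flip: conjg_inv)
    show "g = \<one>" if g: "g \<in> carrier G" and fixes_T: "\<And>t. t \<in> T \<Longrightarrow> conjg g t = t" for g
    proof -
      have "conjg g s \<otimes> conjg g z = s \<otimes> z"
        using fixes_T[OF sT(2)] g s z by (simp add: conjg_mult)
      then have "conjg g z = z" using fixes_T[OF sT(1)] g s z by simp
      then have "g \<in> centralizer G z" using g z by (simp add: in_centralizer_iff_conjg)
      then have "g \<in> {\<one>, z, inv z}" unfolding Cz .
      moreover have "s \<otimes> g = g \<otimes> s"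
        using fixes_T[OF sT(1)] g s by (simp add: conjg_fixes_iff)
      then have "conjg s g = g" using g s by (simp add: conjg_fixes_iff)
      moreover have "conjg s (inv z) \<noteq> inv z"
        using s z by (metis conjg_closed conjg_inv inv_inv)
      ultimately show "g = \<one>" using s(2) by (elim insertE) auto
    qed
  qed
qed

end

theorem proposition2p20:
  fixes G :: "('a, 'b) monoid_scheme" and q :: nat
  assumes "group G"
    and "finite (carrier G)"
    and "center G = {\<one>\<^bsub>G\<^esub>}"
    and "prime q" and "q dvd order G"
    and "\<And>p::nat. prime p \<Longrightarrow> p dvd order G \<Longrightarrow> p \<le> q"
  shows "(card (Cent G) \<ge> q + 2 \<and>
           (card (Cent G) = q + 2 \<longleftrightarrow> (\<exists>n::nat. n > 0 \<and> is_frobenius_cyclic_semidirect G q n))) \<and>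
         (card (Cent G) \<le> order G - 1 \<and>
           (card (Cent G) = order G - 1 \<longleftrightarrow> G \<cong> sym_group 3))"
proof -
  interpret group G by fact
  note fin = assms(2) and Z = assms(3) and q = assms(4,5)
  have nontriv: "carrier G \<noteq> {\<one>\<^bsub>G\<^esub>}"
  proof
    assume "carrier G = {\<one>\<^bsub>G\<^esub>}"
    then have "q dvd 1" using q(2) by (simp add: order_def)
    with q(1) show False by simp
  qed
  have ge: "card (Cent G) \<ge> q + 2" by (rule card_Cent_ge[OF fin Z q])
  have le: "card (Cent G) \<le> order G - 1" by (rule card_Cent_less_order[OF fin Z nontriv])
  have "\<exists>n>0. is_frobenius_cyclic_semidirect G q n" if "card (Cent G) = q + 2"
    by (rule card_Cent_eq_imp_frobenius[OF fin Z q that])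
  moreover have "card (Cent G) = q + 2" if "is_frobenius_cyclic_semidirect G q n" for n
    using frobenius_cyclic_card_Cent_le[OF fin that] ge by simp
  moreover have "G \<cong> sym_group 3" if "card (Cent G) = order G - 1"
    using many_centralizers_imp_sym_group_3[OF fin Z nontriv that] .
  moreover have "card (Cent G) = order G - 1" if iso: "G \<cong> sym_group 3"
  proof -
    have "order G = card (carrier (sym_group 3))"
      using iso_same_card[OF iso] by (simp add: order_def)
    then have six: "order G = 6" by (simp add: sym_group_card_carrier fact_numeral)
    \<comment> \<open>Here \<open>q = 3\<close>, and the lower bound \<open>q + 2\<close> already equals \<open>order G - 1\<close>.\<close>
    have "prime (3::nat)" by simp
    then have "3 \<le> q" using assms(6)[of 3] six by simp
    then show ?thesis using ge le six by simp
  qed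
  ultimately show ?thesis using ge le by blast
qed

end
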